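(* Let $T$ denote the chair tiling. The smallest number of colours needed to colour the faces of $T$ is $3$. Moreover, a 3-colouring of the faces can be obtained by colouring the four first level supertiles, based on orientation, in the following way. Each first level supertile occupies a $4\times4$ axis-parallel square $Q$ with one of its four $2\times2$ quadrants removed (the four orientations correspond to which quadrant is removed), and consists of four tiles: three tiles each contained in one of the three remaining quadrants of $Q$, and one central tile contained in none of the quadrants. Colour the central tile green; colour each of the other three tiles red if it lies in the bottom-left or the top-right quadrant of $Q$, and blue if it lies in the top-left or the bottom-right quadrant of $Q$.
   Context: Chair substitution. The prototile is the L-shaped polygon $C=\overline{[0,2]^2\setminus[1,2]^2}$ (a union of three unit squares). The substitution $\omega$ replaces $C$ by the dissection of $2C=\overline{[0,4]^2\setminus[2,4]^2}$ into four tiles congruent to $C$: the tile $C$; the tile $C+(1,1)$; the tile $\overline{[0,2]\times[2,4]\setminus[1,2]\times[2,3]}$; and the tile $\overline{[2,4]\times[0,2]\setminus[2,3]\times[1,2]}$. It is extended to translates and rotations (by multiples of $90^\circ$) of $C$, and to collections of such tiles, in the obvious covariant way (expand by the factor 2, then dissect each expanded tile). The chair tiling $T$ is the fixed point tiling of the plane produced by this substitution; thus $\omega(T)=T$, and the first level supertiles of $T$ are the patches $\omega(t)$, $t\in T$. The faces of $T$ are its tiles. A colouring of the faces is an assignment of colours to the tiles such that any two distinct tiles whose boundaries share a segment of positive length have different colours. *)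

theory Defs
  imports "HOL-Analysis.Analysis"
begin

section \<open>The chair substitution\<close>

text \<open>The plane is \<^typ>\<open>complex\<close>; for complex numbers, \<^term>\<open>cbox a b\<close> is the closed axis-parallel
  rectangle with lower left corner \<^term>\<open>a\<close> and upper right corner \<^term>\<open>b\<close>.\<close>

definition chair :: "complex set" where
  "chair = closure (cbox 0 (Complex 2 2) - cbox (Complex 1 1) (Complex 2 2))"

definition place :: "complex \<Rightarrow> nat \<Rightarrow> complex set \<Rightarrow> complex set" where
  "place v k S = (\<lambda>z. v + \<i> ^ k * z) ` S"

definition chair_tile :: "complex set \<Rightarrow> bool" where
  "chair_tile t \<longleftrightarrow> (\<exists>v k. t = place v k chair)"

definition dissection :: "complex set set" where
  "dissection =
     {chair,
      place (Complex 1 1) 0 chair,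
      closure (cbox (Complex 0 2) (Complex 2 4) - cbox (Complex 1 2) (Complex 2 3)),
      closure (cbox (Complex 2 0) (Complex 4 2) - cbox (Complex 2 1) (Complex 3 2))}"

text \<open>A chair has no rotational symmetry, so the placement \<^term>\<open>v\<close>, \<^term>\<open>k mod 4\<close> of a tile is
  unique (see \<open>place_chair_eq\<close> below) and the following set consists of just four tiles.\<close>

definition subst_tile :: "complex set \<Rightarrow> complex set set" where
  "subst_tile t = {place (2 * v) k s | v k s. t = place v k chair \<and> s \<in> dissection}"

definition subst_patch :: "complex set set \<Rightarrow> complex set set" where
  "subst_patch P = (\<Union>t\<in>P. subst_tile t)"

definition plane_tiling :: "complex set set \<Rightarrow> bool" where
  "plane_tiling T \<longleftrightarrow>
     (\<forall>t\<in>T. chair_tile t) \<and> \<Union>T = UNIV \<and>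
     pairwise (\<lambda>s t. interior s \<inter> interior t = {}) T"

text \<open>The substitution fixes several tilings of the plane, corresponding to the possible
  configurations of tiles around the origin; any of them may be taken as the chair tiling.\<close>

definition chair_tiling :: "complex set set \<Rightarrow> bool" where
  "chair_tiling T \<longleftrightarrow> plane_tiling T \<and> subst_patch T = T"


section \<open>Colourings of the faces\<close>

definition share_segment :: "complex set \<Rightarrow> complex set \<Rightarrow> bool" where
  "share_segment s t \<longleftrightarrow> (\<exists>a b. a \<noteq> b \<and> closed_segment a b \<subseteq> frontier s \<inter> frontier t)"

definition face_colouring :: "complex set set \<Rightarrow> (complex set \<Rightarrow> 'c) \<Rightarrow> bool" where
  "face_colouring T c \<longleftrightarrow>
     (\<forall>s\<in>T. \<forall>t\<in>T. s \<noteq> t \<and> share_segment s t \<longrightarrow> c s \<noteq> c t)"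

definition face_colourable :: "complex set set \<Rightarrow> nat \<Rightarrow> bool" where
  "face_colourable T n \<longleftrightarrow>
     (\<exists>c :: complex set \<Rightarrow> nat. c ` T \<subseteq> {..<n} \<and> face_colouring T c)"


section \<open>The colouring of first level supertiles by orientation\<close>

datatype colour = Red | Blue | Green

datatype quadrant = BottomLeft | BottomRight | TopLeft | TopRight

fun quadrant_offset :: "quadrant \<Rightarrow> complex" where
  "quadrant_offset BottomLeft = 0"
| "quadrant_offset BottomRight = Complex 2 0"
| "quadrant_offset TopLeft = Complex 0 2"
| "quadrant_offset TopRight = Complex 2 2"

fun quadrant_colour :: "quadrant \<Rightarrow> colour" where
  "quadrant_colour BottomLeft = Red"
| "quadrant_colour BottomRight = Blue"
| "quadrant_colour TopLeft = Blue"
| "quadrant_colour TopRight = Red"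

definition square4 :: "complex \<Rightarrow> complex set" where
  "square4 q = cbox q (q + Complex 4 4)"

definition quadrant_square :: "complex \<Rightarrow> quadrant \<Rightarrow> complex set" where
  "quadrant_square q e = cbox (q + quadrant_offset e) (q + quadrant_offset e + Complex 2 2)"

text \<open>The patch \<^term>\<open>P\<close> occupies the square with lower left corner \<^term>\<open>q\<close> with quadrant \<^term>\<open>d\<close>
  removed; \<^term>\<open>m\<close> is its central tile and \<^term>\<open>f e\<close> its tile in the quadrant \<^term>\<open>e\<close>.\<close>

definition supertile_layout ::
  "complex set set \<Rightarrow> complex \<Rightarrow> quadrant \<Rightarrow> complex set \<Rightarrow> (quadrant \<Rightarrow> complex set) \<Rightarrow> bool" where
  "supertile_layout P q d m f \<longleftrightarrow>
     \<Union>P = closure (square4 q - quadrant_square q d) \<and>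
     P = insert m (f ` (- {d})) \<and>
     (\<forall>e. \<not> m \<subseteq> quadrant_square q e) \<and>
     (\<forall>e. e \<noteq> d \<longrightarrow> f e \<subseteq> quadrant_square q e)"

definition coloured_by_orientation :: "complex set set \<Rightarrow> (complex set \<Rightarrow> colour) \<Rightarrow> bool" where
  "coloured_by_orientation P c \<longleftrightarrow>
     (\<exists>q d m f. supertile_layout P q d m f \<and> c m = Green \<and>
        (\<forall>e. e \<noteq> d \<longrightarrow> c (f e) = quadrant_colour e))"


section \<open>Existence of chair tilings\<close>

definition core :: "complex set" where
  "core = box 0 (Complex 1 2) \<union> box 0 (Complex 2 1)"

lemma chair_alt: "chair = cbox 0 (Complex 1 2) \<union> cbox 0 (Complex 2 1)" (is "_ = ?R")
proof
  have "cbox 0 (Complex 2 2) - cbox (Complex 1 1) (Complex 2 2) \<subseteq> ?R"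
    by (auto simp: in_cbox_complex_iff)
  then show "chair \<subseteq> ?R"
    unfolding chair_def by (intro closure_minimal) auto
  have "core \<subseteq> cbox 0 (Complex 2 2) - cbox (Complex 1 1) (Complex 2 2)"
    by (auto simp: core_def in_cbox_complex_iff in_box_complex_iff)
  then have "closure core \<subseteq> chair"
    unfolding chair_def by (rule closure_mono)
  moreover have "closure core = ?R"
    by (auto simp: core_def closure_box box_eq_empty Basis_complex_def)
  ultimately show "?R \<subseteq> chair" by simp
qed

lemma closure_core: "closure core = chair"
  by (auto simp: chair_alt core_def closure_box box_eq_empty Basis_complex_def)

lemma mem_chair:
  "z \<in> chair \<longleftrightarrow> 0 \<le> Re z \<and> Re z \<le> 2 \<and> 0 \<le> Im z \<and> Im z \<le> 2 \<and> (Re z \<le> 1 \<or> Im z \<le> 1)"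
  by (auto simp: chair_alt in_cbox_complex_iff)

lemma mem_core:
  "z \<in> core \<Longrightarrow> 0 < Re z \<and> Re z < 2 \<and> 0 < Im z \<and> Im z < 2 \<and> (Re z < 1 \<or> Im z < 1)"
  by (auto simp: core_def in_box_complex_iff)

lemma open_core: "open core"
  by (auto simp: core_def)

lemma i_pow_mod4: "\<i> ^ k = \<i> ^ (k mod 4)"
proof -
  have "\<i> ^ k = \<i> ^ (4 * (k div 4) + k mod 4)" by simp
  also have "\<dots> = \<i> ^ (k mod 4)" by (simp only: power_add power_mult) simp
  finally show ?thesis .
qed

lemma i_pow3: "\<i> ^ 3 = - \<i>" "\<i> ^ Suc (Suc (Suc 0)) = - \<i>"
  by (simp_all add: power3_eq_cube)

lemma mod4_cases:
  obtains "k mod 4 = (0::nat)" | "k mod 4 = 1" | "k mod 4 = 2" | "k mod 4 = 3"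
  by linarith

lemma place_mod4: "place v k S = place v (k mod 4) S"
  using i_pow_mod4[of k] by (simp add: place_def)

lemma place_place: "place v k (place w l S) = place (v + \<i> ^ k * w) (k + l) S"
  by (simp add: place_def image_image algebra_simps power_add)

lemma place_0: "place 0 0 S = S"
  by (simp add: place_def)

lemma mem_place: "z \<in> place v k S \<longleftrightarrow> (z - v) / \<i> ^ k \<in> S"
proof
  assume "(z - v) / \<i> ^ k \<in> S"
  moreover have "z = v + \<i> ^ k * ((z - v) / \<i> ^ k)" by simp
  ultimately show "z \<in> place v k S" unfolding place_def by blast
qed (auto simp: place_def)

lemma place_chair_self:
  assumes "place v k chair = chair"
  shows "v = 0 \<and> k mod 4 = 0"
proof -
  have *: "v + \<i> ^ (k mod 4) * z \<in> chair" if "z \<in> chair" for z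
    using assms that place_mod4[of v k chair] by (auto simp: place_def)
  have "0 \<in> chair" "2 \<in> chair" "2 * \<i> \<in> chair"
    by (simp_all add: mem_chair)
  note P = this[THEN *, unfolded mem_chair]
  show ?thesis
  proof (cases k rule: mod4_cases)
    case 1
    have "Re v = 0" "Im v = 0"
      using P unfolding 1 by auto
    with 1 show ?thesis by (simp add: complex_eq_iff)
  next
    case 2
    have "Re v = 2" "Im v = 0"
      using P unfolding 2 by auto
    with P 2 show ?thesis by simp
  next
    case 3
    have "Re v = 2" "Im v = 2"
      using P unfolding 3 by auto
    with P show ?thesis by simp
  next
    case 4
    have "Re v = 0" "Im v = 2"
      using P unfolding 4 by (auto simp: i_pow3)
    with P 4 show ?thesis by (simp add: i_pow3)
  qed
qed

lemma place_chair_eq: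
  assumes "place v k chair = place w l chair"
  shows "v = w \<and> k mod 4 = l mod 4"
proof -
  define m where "m = 3 * l"
  have "\<i> ^ (m + l) = (\<i> ^ 4) ^ l"
    unfolding power_mult[symmetric] by (simp add: m_def)
  then have m: "\<i> ^ (m + l) = 1"
    by simp
  have "place (\<i> ^ m * (v - w)) (m + k) chair = place (- (\<i> ^ m * w)) m (place v k chair)"
    by (simp add: place_place algebra_simps)
  also have "\<dots> = place (- (\<i> ^ m * w)) m (place w l chair)"
    by (simp add: assms)
  also have "\<dots> = place 0 (m + l) chair"
    by (simp add: place_place)
  also have "\<dots> = chair"
    using m by (simp add: place_def)
  finally have "\<i> ^ m * (v - w) = 0 \<and> (m + k) mod 4 = 0"
    by (rule place_chair_self)
  then have "v = w" "(m + k) mod 4 = 0"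
    by auto
  moreover have "(4 * l + k) mod 4 = (l + (m + k) mod 4) mod 4"
    unfolding mod_add_right_eq by (simp add: m_def)
  ultimately have "v = w" "k mod 4 = l mod 4"
    by simp_all
  then show ?thesis by simp
qed

lemma subst_tile_place: "subst_tile (place v k chair) = place (2 * v) k ` dissection"
proof -
  have "place (2 * w) l s = place (2 * v) k s" if "place v k chair = place w l chair" for w l s
    using place_chair_eq[OF that] place_mod4[of _ k] place_mod4[of _ l] by metis
  then show ?thesis
    unfolding subst_tile_def by blast
qed

lemma L_tile_alt:
  "closure (cbox (Complex 0 2) (Complex 2 4) - cbox (Complex 1 2) (Complex 2 3))
     = place (Complex 0 4) 3 chair"
  "closure (cbox (Complex 2 0) (Complex 4 2) - cbox (Complex 2 1) (Complex 3 2))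
     = place (Complex 4 0) 1 chair"
proof -
  have cl: "closure (place v k S) = place v k (closure S)" for v k S
  proof -
    have "place v k S = (+) v ` ((*) (\<i> ^ k) ` S)" for S
      by (auto simp: place_def image_image)
    moreover have "closure ((*) (\<i> ^ k) ` S) = (*) (\<i> ^ k) ` closure S"
      by (rule closure_injective_linear_image[symmetric]) (auto intro: linear_times simp: inj_on_def)
    ultimately show ?thesis
      by (simp add: closure_translation)
  qed
  have 1: "cbox (Complex 0 2) (Complex 2 4) - cbox (Complex 1 2) (Complex 2 3)
     = place (Complex 0 4) 3 (cbox 0 (Complex 2 2) - cbox (Complex 1 1) (Complex 2 2))"
    by (rule set_eqI) (auto simp: mem_place in_cbox_complex_iff i_pow3)
  have 2: "cbox (Complex 2 0) (Complex 4 2) - cbox (Complex 2 1) (Complex 3 2)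
     = place (Complex 4 0) 1 (cbox 0 (Complex 2 2) - cbox (Complex 1 1) (Complex 2 2))"
    by (rule set_eqI) (auto simp: mem_place in_cbox_complex_iff)
  show "closure (cbox (Complex 0 2) (Complex 2 4) - cbox (Complex 1 2) (Complex 2 3))
     = place (Complex 0 4) 3 chair"
    unfolding 1 cl chair_def ..
  show "closure (cbox (Complex 2 0) (Complex 4 2) - cbox (Complex 2 1) (Complex 3 2))
     = place (Complex 4 0) 1 chair"
    unfolding 2 cl chair_def ..
qed

lemma dissection_alt:
  "dissection = {place 0 0 chair, place (Complex 1 1) 0 chair,
     place (Complex 0 4) 3 chair, place (Complex 4 0) 1 chair}"
  unfolding dissection_def L_tile_alt place_0 ..

lemma Union_dissection: "\<Union>dissection = (*) 2 ` chair"
proof (rule set_eqI)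
  fix z :: complex
  have "z \<in> (*) 2 ` chair \<longleftrightarrow> z / 2 \<in> chair"
    by (auto simp: image_iff intro!: bexI[of _ "z / 2"])
  also have "\<dots> \<longleftrightarrow> 0 \<le> Re z \<and> Re z \<le> 4 \<and> 0 \<le> Im z \<and> Im z \<le> 4 \<and> (Re z \<le> 2 \<or> Im z \<le> 2)"
    by (simp add: mem_chair)
  moreover have "z \<in> place 0 0 chair \<longleftrightarrow>
      0 \<le> Re z \<and> Re z \<le> 2 \<and> 0 \<le> Im z \<and> Im z \<le> 2 \<and> (Re z \<le> 1 \<or> Im z \<le> 1)"
    by (simp add: mem_place mem_chair)
  moreover have "z \<in> place (Complex 1 1) 0 chair \<longleftrightarrow>
      1 \<le> Re z \<and> Re z \<le> 3 \<and> 1 \<le> Im z \<and> Im z \<le> 3 \<and> (Re z \<le> 2 \<or> Im z \<le> 2)"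
    by (simp add: mem_place mem_chair algebra_simps)
  moreover have "z \<in> place (Complex 0 4) 3 chair \<longleftrightarrow>
      0 \<le> Re z \<and> Re z \<le> 2 \<and> 2 \<le> Im z \<and> Im z \<le> 4 \<and> (Re z \<le> 1 \<or> 3 \<le> Im z)"
    by (simp add: mem_place mem_chair i_pow3) linarith
  moreover have "z \<in> place (Complex 4 0) 1 chair \<longleftrightarrow>
      2 \<le> Re z \<and> Re z \<le> 4 \<and> 0 \<le> Im z \<and> Im z \<le> 2 \<and> (3 \<le> Re z \<or> Im z \<le> 1)"
    by (simp add: mem_place mem_chair) linarith
  ultimately show "z \<in> \<Union>dissection \<longleftrightarrow> z \<in> (*) 2 ` chair"
    unfolding dissection_alt Union_insert Union_empty Un_iff empty_iff by smt
qed

lemma interior_place_disjoint: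
  assumes "place v k core \<inter> place w l core = {}"
  shows "interior (place v k chair) \<inter> interior (place w l chair) = {}"
proof (rule ccontr)
  have op: "open (place v k core)" for v k
  proof -
    have "place v k core = (\<lambda>z. (z - v) / \<i> ^ k) -` core"
      by (auto simp: mem_place)
    then show ?thesis
      using open_core by (auto intro!: open_vimage continuous_intros)
  qed
  have sub: "place v k chair \<subseteq> closure (place v k core)" for v k
  proof -
    have "continuous_on (closure core) (\<lambda>z. v + \<i> ^ k * z)"
      by (intro continuous_intros)
    then show ?thesis
      unfolding place_def closure_core[symmetric]
      by (intro image_closure_subset) (auto intro: closure_subset[THEN subsetD])
  qed
  define W where "W = interior (place v k chair) \<inter> interior (place w l chair)"
  assume "interior (place v k chair) \<inter> interior (place w l chair) \<noteq> {}"
  then have W: "W \<noteq> {}" "open W" "W \<subseteq> closure (place v k core)" "W \<subseteq> closure (place w l core)"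
    using sub[of v k] sub[of w l] interior_subset by (auto simp: W_def)
  then have "W \<inter> place v k core \<noteq> {}"
    using open_Int_closure_eq_empty[of W "place v k core"] by blast
  moreover have "open (W \<inter> place v k core)"
    using W op by auto
  ultimately have "W \<inter> place v k core \<inter> place w l core \<noteq> {}"
    using open_Int_closure_eq_empty[of "W \<inter> place v k core" "place w l core"] W by blast
  then show False using assms by blast
qed

lemma dissection_disjoint:
  "pairwise (\<lambda>s t. interior (place v k s) \<inter> interior (place v k t) = {}) dissection"
proof -
  have *: "interior (place v k (place a m chair)) \<inter> interior (place v k (place b n chair)) = {}"
    if "place a m core \<inter> place b n core = {}" for a m b n
  proof -
    have "inj (\<lambda>z. v + \<i> ^ k * z)" by (auto simp: inj_on_def)
    then have "place v k (place a m core) \<inter> place v k (place b n core) = {}"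
      using that unfolding place_def[of v k] by (simp add: image_Int[symmetric])
    then show ?thesis
      unfolding place_place by (rule interior_place_disjoint)
  qed
  have sym: "interior X \<inter> interior Y = {} \<Longrightarrow> interior Y \<inter> interior X = {}" for X Y :: "complex set"
    by blast
  have d: "place 0 0 core \<inter> place (Complex 1 1) 0 core = {}"
    "place 0 0 core \<inter> place (Complex 0 4) 3 core = {}"
    "place 0 0 core \<inter> place (Complex 4 0) 1 core = {}"
    "place (Complex 1 1) 0 core \<inter> place (Complex 0 4) 3 core = {}"
    "place (Complex 1 1) 0 core \<inter> place (Complex 4 0) 1 core = {}"
    "place (Complex 0 4) 3 core \<inter> place (Complex 4 0) 1 core = {}"
    by (auto simp: mem_place i_pow3 dest!: mem_core)
  show ?thesis
    unfolding dissection_alt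
  proof (rule pairwiseI)
    fix s t
    assume "s \<in> {place 0 0 chair, place (Complex 1 1) 0 chair,
        place (Complex 0 4) 3 chair, place (Complex 4 0) 1 chair}"
      and "t \<in> {place 0 0 chair, place (Complex 1 1) 0 chair,
        place (Complex 0 4) 3 chair, place (Complex 4 0) 1 chair}"
      and "s \<noteq> t"
    then show "interior (place v k s) \<inter> interior (place v k t) = {}"
      using d[THEN *] d[THEN *, THEN sym]
      by - (elim insertE emptyE; hypsubst; (assumption | (erule notE, rule refl)))
  qed
qed

lemma Union_subst_tile:
  assumes "chair_tile t"
  shows "\<Union>(subst_tile t) = (*) 2 ` t"
proof -
  obtain v k where t: "t = place v k chair"
    using assms by (auto simp: chair_tile_def)
  have "\<Union>(subst_tile t) = place (2 * v) k (\<Union>dissection)"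
    unfolding t subst_tile_place by (auto simp: place_def)
  then show ?thesis
    unfolding Union_dissection t by (simp add: place_def image_image algebra_simps)
qed

lemma chair_tile_subst:
  assumes "chair_tile t" "s \<in> subst_tile t"
  shows "chair_tile s"
proof -
  obtain v k where "t = place v k chair"
    using assms by (auto simp: chair_tile_def)
  then obtain r where r: "s = place (2 * v) k r" "r \<in> dissection"
    using assms by (auto simp: subst_tile_place)
  then obtain w l where "r = place w l chair"
    unfolding dissection_alt by blast
  then show ?thesis
    using r unfolding chair_tile_def by (metis place_place)
qed

definition patch :: "complex set set \<Rightarrow> bool" where
  "patch P \<longleftrightarrow> (\<forall>t\<in>P. chair_tile t) \<and> pairwise (\<lambda>s t. interior s \<inter> interior t = {}) P"

lemma patch_subst:
  assumes "patch P"
  shows "patch (subst_patch P)"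
proof -
  have "interior s \<inter> interior s' = {}"
    if *: "t \<in> P" "t' \<in> P" "s \<in> subst_tile t" "s' \<in> subst_tile t'" "s \<noteq> s'" for s s' t t'
  proof (cases "t = t'")
    case True
    have "chair_tile t"
      using assms * by (simp add: patch_def)
    then obtain v k where t: "t = place v k chair"
      by (auto simp: chair_tile_def)
    obtain r r' where "s = place (2 * v) k r" "r \<in> dissection"
        "s' = place (2 * v) k r'" "r' \<in> dissection"
      using * unfolding True[symmetric] t subst_tile_place by auto
    with \<open>s \<noteq> s'\<close> show ?thesis
      using dissection_disjoint[of "2 * v" k] unfolding pairwise_def by metis
  next
    case False
    then have dis: "interior t \<inter> interior t' = {}"
      using assms * by (auto simp: patch_def pairwise_def)
    have int: "interior ((*) 2 ` A) = (*) 2 ` interior A" for A :: "complex set"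
      by (rule interior_bijective_linear_image)
         (auto simp: linear_times bij_def inj_on_def intro!: surjI[of "(*) 2" "\<lambda>z. z / 2"])
    have "s \<subseteq> (*) 2 ` t" "s' \<subseteq> (*) 2 ` t'"
      using * assms Union_subst_tile[of t] Union_subst_tile[of t'] by (auto simp: patch_def)
    then have "interior s \<subseteq> (*) 2 ` interior t" "interior s' \<subseteq> (*) 2 ` interior t'"
      unfolding int[symmetric] by (auto intro: interior_mono[THEN subsetD])
    then show ?thesis
      using dis by fastforce
  qed
  then have "pairwise (\<lambda>s t. interior s \<inter> interior t = {}) (subst_patch P)"
    unfolding subst_patch_def by (intro pairwiseI) (elim UN_E, assumption)
  moreover have "\<forall>s\<in>subst_patch P. chair_tile s"
    using assms chair_tile_subst by (auto simp: patch_def subst_patch_def)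
  ultimately show ?thesis
    by (simp add: patch_def)
qed

lemma Union_subst_patch:
  assumes "patch P"
  shows "\<Union>(subst_patch P) = (*) 2 ` \<Union>P"
proof -
  have "\<Union>(subst_patch P) = (\<Union>t\<in>P. \<Union>(subst_tile t))"
    by (auto simp: subst_patch_def)
  also have "\<dots> = (\<Union>t\<in>P. (*) 2 ` t)"
    using assms by (intro SUP_cong refl Union_subst_tile) (auto simp: patch_def)
  finally show ?thesis
    by (simp add: image_Union)
qed

definition seed :: "complex set set" where
  "seed = (\<lambda>k. place 0 k chair) ` {0, 1, 2, 3}"

lemma patch_seed: "patch seed"
proof -
  have sym: "interior X \<inter> interior Y = {} \<Longrightarrow> interior Y \<inter> interior X = {}" for X Y :: "complex set"
    by blast
  have d: "place 0 0 core \<inter> place 0 1 core = {}" "place 0 0 core \<inter> place 0 2 core = {}"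
    "place 0 0 core \<inter> place 0 3 core = {}" "place 0 1 core \<inter> place 0 2 core = {}"
    "place 0 1 core \<inter> place 0 3 core = {}" "place 0 2 core \<inter> place 0 3 core = {}"
    by (auto simp: mem_place i_pow3 dest!: mem_core)
  show ?thesis
    unfolding patch_def seed_def image_insert image_empty pairwise_insert
    using d[THEN interior_place_disjoint] d[THEN interior_place_disjoint, THEN sym]
    by (auto simp: chair_tile_def)
qed

lemma seed_subset: "seed \<subseteq> subst_patch seed"
proof
  fix t assume "t \<in> seed"
  then obtain k where "t = place 0 k chair"
    by (auto simp: seed_def)
  then have "t \<in> subst_tile t"
    by (auto simp: subst_tile_place dissection_def)
  with \<open>t \<in> seed\<close> show "t \<in> subst_patch seed"
    by (auto simp: subst_patch_def)
qed

lemma Union_seed: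
  assumes "\<bar>Re z\<bar> \<le> 1" "\<bar>Im z\<bar> \<le> 1"
  shows "z \<in> \<Union>seed"
proof -
  have "z \<in> place 0 0 chair \<or> z \<in> place 0 1 chair \<or> z \<in> place 0 2 chair \<or> z \<in> place 0 3 chair"
  proof (cases "0 \<le> Re z"; cases "0 \<le> Im z")
    assume "0 \<le> Re z" "0 \<le> Im z"
    with assms have "z \<in> place 0 0 chair" by (simp add: mem_place mem_chair)
    then show ?thesis by blast
  next
    assume "0 \<le> Re z" "\<not> 0 \<le> Im z"
    with assms have "z \<in> place 0 3 chair" by (simp add: mem_place mem_chair i_pow3)
    then show ?thesis by blast
  next
    assume "\<not> 0 \<le> Re z" "0 \<le> Im z"
    with assms have "z \<in> place 0 1 chair" by (simp add: mem_place mem_chair)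
    then show ?thesis by blast
  next
    assume "\<not> 0 \<le> Re z" "\<not> 0 \<le> Im z"
    with assms have "z \<in> place 0 2 chair" by (simp add: mem_place mem_chair)
    then show ?thesis by blast
  qed
  then show ?thesis by (simp add: seed_def)
qed

theorem chair_tiling_exists: "\<exists>T. chair_tiling T"
proof
  define S where "S n = (subst_patch ^^ n) seed" for n
  define T where "T = (\<Union>n. S n)"
  have S_Suc: "S (Suc n) = subst_patch (S n)" for n
    by (simp add: S_def)
  have mono: "subst_patch P \<subseteq> subst_patch P'" if "P \<subseteq> P'" for P P'
    using that by (auto simp: subst_patch_def)
  have "S n \<subseteq> S (Suc n)" for n
  proof (induction n)
    case 0
    then show ?case using seed_subset by (simp add: S_def)
  next
    case (Suc n)
    then show ?case unfolding S_Suc by (rule mono)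
  qed
  then have inc: "S m \<subseteq> S n" if "m \<le> n" for m n
    using that by (rule lift_Suc_mono_le)
  have patch: "patch (S n)" for n
    by (induction n) (simp_all add: patch_seed patch_subst S_Suc S_def[of 0])
  have Un: "\<Union>(S n) = (*) (2 ^ n) ` \<Union>seed" for n
  proof (induction n)
    case 0
    then show ?case by (simp add: S_def)
  next
    case (Suc n)
    then show ?case
      unfolding S_Suc Union_subst_patch[OF patch] by (simp add: image_image mult.assoc)
  qed
  have "z \<in> \<Union>T" for z :: complex
  proof -
    obtain n where n: "cmod z < 2 ^ n"
      using real_arch_pow[of 2 "cmod z"] by auto
    define w where "w = z / 2 ^ n"
    have z: "z = 2 ^ n * w" by (simp add: w_def)
    have "cmod w \<le> 1"
      using n by (simp add: w_def norm_divide norm_power)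
    then have "w \<in> \<Union>seed"
      using abs_Re_le_cmod[of w] abs_Im_le_cmod[of w] by (intro Union_seed) linarith+
    then have "z \<in> \<Union>(S n)"
      unfolding Un z by blast
    then show ?thesis by (auto simp: T_def)
  qed
  moreover have "\<forall>t\<in>T. chair_tile t"
    using patch by (auto simp: T_def patch_def)
  moreover have "pairwise (\<lambda>s t. interior s \<inter> interior t = {}) T"
  proof (rule pairwiseI)
    fix s t assume st: "s \<in> T" "t \<in> T" "s \<noteq> t"
    then obtain m n where "s \<in> S m" "t \<in> S n" by (auto simp: T_def)
    then have "s \<in> S (max m n)" "t \<in> S (max m n)"
      using inc[of m "max m n"] inc[of n "max m n"] by auto
    with st patch[of "max m n"] show "interior s \<inter> interior t = {}"
      by (auto simp: patch_def pairwise_def)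
  qed
  moreover have "subst_patch T = T"
  proof -
    have "subst_patch T = (\<Union>n. S (Suc n))"
      by (auto simp: T_def S_Suc subst_patch_def)
    also have "\<dots> = T"
      using inc[of _ "Suc _"] unfolding T_def by (auto, metis inc le_SucI le_refl subsetD)
    finally show ?thesis .
  qed
  ultimately show "chair_tiling T"
    by (auto simp: chair_tiling_def plane_tiling_def)
qed

end

theory Submission
  imports Defs
begin

text \<open>Describe a tile by the centre \<open>u\<close> of its bounding \<open>2 \<times> 2\<close> square and its orientation \<open>k\<close>. Then
  the substitution sends \<open>(u, k)\<close> to \<open>(2u, k)\<close> (the central tile) and to
  \<open>(2u - \<i>\<^sup>j (1 + \<i>), j)\<close> for the three \<open>j \<noteq> k + 2\<close> modulo 4. A tile containing the origin is its own
  child, hence has its centre in the lattice \<open>L\<close> of Gaussian integers with even coordinate sum; any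
  other tile has an ancestor containing the origin, and \<open>L\<close> is inherited by children, so all centres
  lie in \<open>L\<close>. Central tiles have centres in \<open>2L\<close>, the other ones have centres with odd
  coordinates, on which red and blue form a checkerboard. Either way, two distinct centres of the same
  colour differ by an element of \<open>2L\<close>, so their bounding squares share no segment. Three colours are
  necessary because a supertile contains three mutually adjacent tiles.\<close>

section \<open>Tiles in terms of centre and orientation\<close>

text \<open>The centre \<open>u\<close> of the bounding square is also the reflex corner of the L,
  so a quarter turn about \<open>u\<close> changes the orientation but not the bounding
  square.\<close>

definition chair_at :: "complex \<Rightarrow> nat \<Rightarrow> complex set" where
  "chair_at u k = place (u - \<i> ^ k * Complex 1 1) k chair"

lemma chair_at_mod4: "chair_at u k = chair_at u (k mod 4)"
  using i_pow_mod4[of k] place_mod4[of _ k] by (simp add: chair_at_def)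

lemma chair_tile_chair_at:
  assumes "chair_tile t"
  obtains u k where "t = chair_at u k" "k < 4"
proof -
  obtain v k where "t = place v k chair"
    using assms by (auto simp: chair_tile_def)
  then have "t = chair_at (v + \<i> ^ k * Complex 1 1) k"
    by (simp add: chair_at_def)
  then show ?thesis
    using that[of _ "k mod 4"] chair_at_mod4 by auto
qed

lemma chair_at_eq: "chair_at u k = chair_at w l \<Longrightarrow> u = w"
  unfolding chair_at_def by (drule place_chair_eq) (metis i_pow_mod4 diff_add_cancel)

text \<open>In coordinates centred at \<open>u\<close> and turned by \<open>k\<close>, every tile is
  the same square without its open upper right quadrant. This allows computations with
  \<open>k\<close> left symbolic.\<close>

lemma mem_chair_at:
  "u + \<i> ^ k * z \<in> chair_at u k \<longleftrightarrow>
     \<bar>Re z\<bar> \<le> 1 \<and> \<bar>Im z\<bar> \<le> 1 \<and> (Re z \<le> 0 \<or> Im z \<le> 0)"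
proof -
  have "(u + \<i> ^ k * z - (u - \<i> ^ k * Complex 1 1)) / \<i> ^ k = z + Complex 1 1"
    by (simp add: field_simps)
  then show ?thesis
    unfolding chair_at_def mem_place by (auto simp: mem_chair abs_le_iff)
qed

lemma chair_at_eq_Collect:
  "chair_at u 0 = {z. \<bar>Re z - Re u\<bar> \<le> 1 \<and> \<bar>Im z - Im u\<bar> \<le> 1 \<and> (Re z \<le> Re u \<or> Im z \<le> Im u)}"
  "chair_at u 1 = {z. \<bar>Re z - Re u\<bar> \<le> 1 \<and> \<bar>Im z - Im u\<bar> \<le> 1 \<and> (Re u \<le> Re z \<or> Im z \<le> Im u)}"
  "chair_at u 2 = {z. \<bar>Re z - Re u\<bar> \<le> 1 \<and> \<bar>Im z - Im u\<bar> \<le> 1 \<and> (Re u \<le> Re z \<or> Im u \<le> Im z)}"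
  "chair_at u 3 = {z. \<bar>Re z - Re u\<bar> \<le> 1 \<and> \<bar>Im z - Im u\<bar> \<le> 1 \<and> (Re z \<le> Re u \<or> Im u \<le> Im z)}"
proof -
  have *: "z \<in> chair_at u k \<longleftrightarrow> \<bar>Re ((z - u) / \<i> ^ k)\<bar> \<le> 1 \<and> \<bar>Im ((z - u) / \<i> ^ k)\<bar> \<le> 1 \<and>
      (Re ((z - u) / \<i> ^ k) \<le> 0 \<or> Im ((z - u) / \<i> ^ k) \<le> 0)" for z k
    using mem_chair_at[of u k "(z - u) / \<i> ^ k"] by simp
  show "chair_at u 0 = {z. \<bar>Re z - Re u\<bar> \<le> 1 \<and> \<bar>Im z - Im u\<bar> \<le> 1 \<and> (Re z \<le> Re u \<or> Im z \<le> Im u)}"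
    by (auto simp: *)
  show "chair_at u 1 = {z. \<bar>Re z - Re u\<bar> \<le> 1 \<and> \<bar>Im z - Im u\<bar> \<le> 1 \<and> (Re u \<le> Re z \<or> Im z \<le> Im u)}"
    unfolding set_eq_iff mem_Collect_eq * by (auto simp: abs_minus_commute)
  show "chair_at u 2 = {z. \<bar>Re z - Re u\<bar> \<le> 1 \<and> \<bar>Im z - Im u\<bar> \<le> 1 \<and> (Re u \<le> Re z \<or> Im u \<le> Im z)}"
    unfolding set_eq_iff mem_Collect_eq * by (auto simp: abs_minus_commute)
  show "chair_at u 3 = {z. \<bar>Re z - Re u\<bar> \<le> 1 \<and> \<bar>Im z - Im u\<bar> \<le> 1 \<and> (Re z \<le> Re u \<or> Im u \<le> Im z)}"
    unfolding set_eq_iff mem_Collect_eq * by (auto simp: abs_minus_commute i_pow3)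
qed

lemma chair_at_subset_square:
  assumes "z \<in> chair_at u k"
  shows "\<bar>Re z - Re u\<bar> \<le> 1" "\<bar>Im z - Im u\<bar> \<le> 1"
proof -
  have "z \<in> chair_at u (k mod 4)"
    using assms chair_at_mod4 by simp
  then show "\<bar>Re z - Re u\<bar> \<le> 1" "\<bar>Im z - Im u\<bar> \<le> 1"
    by (cases k rule: mod4_cases; simp add: chair_at_eq_Collect chair_at_eq_Collect(2)[simplified])+
qed

section \<open>Interiors, closures and overlapping tiles\<close>

lemma open_place_core: "open (place v k core)"
proof -
  have "place v k core = (\<lambda>z. (z - v) / \<i> ^ k) -` core"
    by (auto simp: mem_place)
  then show ?thesis
    using open_core by (auto intro!: open_vimage continuous_intros)
qed

lemma closure_place: "closure (place v k S) = place v k (closure S)"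
proof -
  have "place v k S = (+) v ` ((*) (\<i> ^ k) ` S)" for S
    by (auto simp: place_def image_image)
  moreover have "closure ((*) (\<i> ^ k) ` S) = (*) (\<i> ^ k) ` closure S"
    by (rule closure_injective_linear_image[symmetric]) (auto intro: linear_times simp: inj_on_def)
  ultimately show ?thesis
    by (simp add: closure_translation)
qed

lemma closed_chair_at: "closed (chair_at u k)"
  unfolding chair_at_def closure_core[symmetric] closure_place[symmetric] by simp

lemma mem_interior_chair_at:
  assumes "\<bar>Re z\<bar> < 1" "\<bar>Im z\<bar> < 1" "Re z < 0 \<or> Im z < 0"
  shows "u + \<i> ^ k * z \<in> interior (chair_at u k)"
proof -
  have "z + Complex 1 1 \<in> core"
    using assms by (auto simp: core_def in_box_complex_iff)
  moreover have "u + \<i> ^ k * z = (u - \<i> ^ k * Complex 1 1) + \<i> ^ k * (z + Complex 1 1)"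
    by (simp add: algebra_simps)
  ultimately have "u + \<i> ^ k * z \<in> place (u - \<i> ^ k * Complex 1 1) k core"
    unfolding place_def by blast
  moreover have "place (u - \<i> ^ k * Complex 1 1) k core \<subseteq> chair_at u k"
    unfolding chair_at_def closure_core[symmetric] closure_place[symmetric] by (rule closure_subset)
  ultimately show ?thesis
    using open_place_core by (meson interiorI)
qed

text \<open>Moving from the midpoint of the two centres along a diagonal that points into a filled
  quadrant of both tiles gives a common interior point.\<close>

lemma near_chairs_overlap:
  assumes "\<bar>Re u - Re w\<bar> < 1" "\<bar>Im u - Im w\<bar> < 1"
  shows "interior (chair_at u k) \<inter> chair_at w l \<noteq> {}"
proof -
  define p where "p a b = (u + w) / 2 + Complex a b / 2" for a b
  have wlog: "interior (chair_at u k) \<inter> chair_at w l \<noteq> {}" if "k < 4" "l < 4" for k l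
  proof -
    have inI: "p a b \<in> interior (chair_at u j) \<and> p a b \<in> chair_at w j"
      if "\<bar>a\<bar> = 1" "\<bar>b\<bar> = 1" and
        neg: "Re (Complex a b / \<i> ^ j) < 0 \<or> Im (Complex a b / \<i> ^ j) < 0" and "j < 4"
      for a b j
    proof -
      have near: "x + (d + Complex a b / 2) \<in> interior (chair_at x j)"
        if d: "\<bar>Re d\<bar> < 1 / 2" "\<bar>Im d\<bar> < 1 / 2" for x d
      proof -
        \<comment> \<open>Division by \<open>\<i> ^ j\<close> only permutes coordinates up to sign.
          A coordinate of \<open>e / 2\<close> equal to \<open>-1/2\<close> stays negative after
          adding \<open>f\<close>, whose coordinates are below \<open>1/2\<close> in absolute
          value.\<close>
        define e where "e = Complex a b / \<i> ^ j"
        define f where "f = d / \<i> ^ j"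
        consider "j = 0" | "j = 1" | "j = 2" | "j = 3" using \<open>j < 4\<close> by linarith
        then have "\<bar>Re e\<bar> = 1 \<and> \<bar>Im e\<bar> = 1 \<and> \<bar>Re f\<bar> < 1 / 2 \<and> \<bar>Im f\<bar> < 1 / 2"
          using \<open>\<bar>a\<bar> = 1\<close> \<open>\<bar>b\<bar> = 1\<close> d by cases (simp_all add: e_def f_def i_pow3)
        moreover have "Re e < 0 \<or> Im e < 0"
          using neg by (simp add: e_def)
        ultimately have "x + \<i> ^ j * (f + e / 2) \<in> interior (chair_at x j)"
          by (intro mem_interior_chair_at; simp; linarith)
        then show ?thesis
          by (simp add: e_def f_def algebra_simps)
      qed
      have "p a b = u + ((w - u) / 2 + Complex a b / 2)" "p a b = w + ((u - w) / 2 + Complex a b / 2)"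
        by (simp_all add: p_def field_simps)
      moreover have "u + ((w - u) / 2 + Complex a b / 2) \<in> interior (chair_at u j)"
        using assms by (intro near) auto
      moreover have "w + ((u - w) / 2 + Complex a b / 2) \<in> interior (chair_at w j)"
        using assms by (intro near) auto
      ultimately show ?thesis
        using interior_subset by (metis subsetD)
    qed
    have "k \<in> {0, 1, 2, 3}" "l \<in> {0, 1, 2, 3}"
      using \<open>k < 4\<close> \<open>l < 4\<close> by auto
    \<comment> \<open>Each orientation rules out just one of the four diagonal directions, so two
      orientations leave at least two.\<close>
    then have "\<exists>a\<in>{1, - 1}. \<exists>b\<in>{1, - 1}.
        (Re (Complex a b / \<i> ^ k) < 0 \<or> Im (Complex a b / \<i> ^ k) < 0) \<and>
        (Re (Complex a b / \<i> ^ l) < 0 \<or> Im (Complex a b / \<i> ^ l) < 0)"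
      unfolding insert_iff empty_iff by (elim disjE) (auto simp: i_pow3)
    then obtain a b where "a \<in> {1, - 1}" "b \<in> {1, - 1}" and
        k: "Re (Complex a b / \<i> ^ k) < 0 \<or> Im (Complex a b / \<i> ^ k) < 0" and
        l: "Re (Complex a b / \<i> ^ l) < 0 \<or> Im (Complex a b / \<i> ^ l) < 0"
      by blast
    then have ab: "\<bar>a\<bar> = 1" "\<bar>b\<bar> = 1"
      by auto
    have "p a b \<in> interior (chair_at u k)" "p a b \<in> chair_at w l"
      using inI[OF ab k \<open>k < 4\<close>] inI[OF ab l \<open>l < 4\<close>] by blast+
    then show ?thesis by blast
  qed
  have "interior (chair_at u (k mod 4)) \<inter> chair_at w (l mod 4) \<noteq> {}"
    by (rule wlog) simp_all
  then show ?thesis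
    by (metis chair_at_mod4)
qed

section \<open>The substitution in centre coordinates\<close>

lemma subst_chair_at:
  "subst_tile (chair_at u k) =
     insert (chair_at (2 * u) k)
       ((\<lambda>j. chair_at (2 * u - \<i> ^ j * Complex 1 1) j) ` {k, k + 1, k + 3})"
proof -
  \<comment> \<open>In the doubled chair, with centre \<open>2 * Complex 1 1\<close>, these two
    placement points are corners of the bounding square. They are written as that centre minus a
    turned \<open>2 * Complex 1 1\<close>, the form needed to read off the centres of the
    children.\<close>
  have c: "Complex 0 4 = 2 * Complex 1 1 - 2 * (\<i> ^ 3 * Complex 1 1)"
    "Complex 4 0 = 2 * Complex 1 1 - 2 * (\<i> * Complex 1 1)"
    by (simp_all add: complex_eq_iff i_pow3)
  have
    "place (2 * (u - \<i> ^ k * Complex 1 1)) k (place 0 0 chair) =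
      chair_at (2 * u - \<i> ^ k * Complex 1 1) k"
    "place (2 * (u - \<i> ^ k * Complex 1 1)) k (place (Complex 1 1) 0 chair) = chair_at (2 * u) k"
    "place (2 * (u - \<i> ^ k * Complex 1 1)) k (place (Complex 0 4) 3 chair) =
      chair_at (2 * u - \<i> ^ (k + 3) * Complex 1 1) (k + 3)"
    "place (2 * (u - \<i> ^ k * Complex 1 1)) k (place (Complex 4 0) 1 chair) =
      chair_at (2 * u - \<i> ^ (k + 1) * Complex 1 1) (k + 1)"
    unfolding chair_at_def place_place c by (simp_all add: power_add algebra_simps)
  then show ?thesis
    unfolding chair_at_def[of u] subst_tile_place dissection_alt by auto
qed

section \<open>Overlap and adjacency within a tiling\<close>

lemma plane_tiling_chair_at:
  assumes "plane_tiling T" "t \<in> T"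
  obtains u k where "t = chair_at u k" "k < 4"
  using assms chair_tile_chair_at unfolding plane_tiling_def by metis

text \<open>Disjointness of interiors extends to interior against whole tile: \<open>t\<close> is
  the closure of its open core, and an open set that misses the core misses its closure.\<close>

lemma plane_tiling_overlap_imp_eq:
  assumes T: "plane_tiling T" and st: "s \<in> T" "t \<in> T" and p: "p \<in> interior s" "p \<in> t"
  shows "s = t"
proof (rule ccontr)
  assume "s \<noteq> t"
  then have dis: "interior s \<inter> interior t = {}"
    using T st by (auto simp: plane_tiling_def pairwise_def)
  obtain v k where t: "t = place v k chair"
    using T st by (auto simp: plane_tiling_def chair_tile_def)
  then have cl: "t = closure (place v k core)"
    by (simp add: closure_core closure_place)
  then have "place v k core \<subseteq> interior t"
    by (simp add: interior_maximal closure_subset open_place_core)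
  then have "interior s \<inter> place v k core = {}"
    using dis by blast
  then have "interior s \<inter> t = {}"
    unfolding cl by (simp add: open_Int_closure_eq_empty)
  then show False
    using p by blast
qed

lemma plane_tiling_near_imp_eq:
  assumes "plane_tiling T" "chair_at u k \<in> T" "chair_at w l \<in> T"
    and "\<bar>Re u - Re w\<bar> < 1" "\<bar>Im u - Im w\<bar> < 1"
  shows "chair_at u k = chair_at w l"
  using near_chairs_overlap[OF assms(4,5)] plane_tiling_overlap_imp_eq[OF assms(1-3)] by blast

text \<open>Distinct tiles of a tiling meet only in their frontiers, so adjacency can be checked
  without computing any frontier.\<close>

lemma share_segmentI:
  assumes T: "plane_tiling T" and st: "s \<in> T" "t \<in> T" "s \<noteq> t"
    and ab: "a \<noteq> b" "closed_segment a b \<subseteq> s \<inter> t"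
  shows "share_segment s t"
proof -
  have "s \<inter> t \<subseteq> frontier s \<inter> frontier t"
    using plane_tiling_overlap_imp_eq[OF T] st closure_subset
    unfolding frontier_def by blast
  then show ?thesis
    using ab unfolding share_segment_def by blast
qed

text \<open>Both ends of the segment lie in both bounding squares. A distance of 2 in one coordinate
  fixes that coordinate of every common point, so a distance of 2 in both would force
  \<open>a = b\<close>.\<close>

lemma share_segment_centres:
  assumes "share_segment (chair_at u k) (chair_at w l)"
  shows "\<bar>Re u - Re w\<bar> \<le> 2" "\<bar>Im u - Im w\<bar> \<le> 2" "\<bar>Re u - Re w\<bar> < 2 \<or> \<bar>Im u - Im w\<bar> < 2"
proof -
  obtain a b where ab: "a \<noteq> b"
      "closed_segment a b \<subseteq> frontier (chair_at u k) \<inter> frontier (chair_at w l)"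
    using assms by (auto simp: share_segment_def)
  moreover have "frontier (chair_at x j) \<subseteq> chair_at x j" for x j
    using closed_chair_at by (simp add: frontier_subset_eq)
  moreover have "a \<in> closed_segment a b" "b \<in> closed_segment a b"
    by simp_all
  ultimately have mem: "a \<in> chair_at u k" "a \<in> chair_at w l" "b \<in> chair_at u k" "b \<in> chair_at w l"
    by blast+
  note sq = mem[THEN chair_at_subset_square(1), unfolded abs_le_iff]
    mem[THEN chair_at_subset_square(2), unfolded abs_le_iff]
  show "\<bar>Re u - Re w\<bar> \<le> 2" "\<bar>Im u - Im w\<bar> \<le> 2"
    unfolding abs_le_iff using sq by linarith+
  have "Re a = Re b" if "\<bar>Re u - Re w\<bar> \<ge> 2"
    using sq that by linarith
  moreover have "Im a = Im b" if "\<bar>Im u - Im w\<bar> \<ge> 2"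
    using sq that by linarith
  ultimately show "\<bar>Re u - Re w\<bar> < 2 \<or> \<bar>Im u - Im w\<bar> < 2"
    using \<open>a \<noteq> b\<close> by (metis complex_eqI not_less)
qed

section \<open>The lattice of centres\<close>

text \<open>This is the ideal of the Gaussian integers generated by \<open>1 + \<i>\<close>.\<close>

definition even_gauss :: "complex \<Rightarrow> bool" where
  "even_gauss u \<longleftrightarrow> (\<exists>x y. u = Complex (of_int x) (of_int y) \<and> even (x + y))"

lemma even_gaussI:
  "Re u = of_int x \<Longrightarrow> Im u = of_int y \<Longrightarrow> even (x + y) \<Longrightarrow> even_gauss u"
  unfolding even_gauss_def by (metis complex_surj)

lemma even_gauss_diff:
  assumes "even_gauss u" "even_gauss w"
  shows "even_gauss (u - w)"
proof -
  obtain x y x' y' where "u = Complex (of_int x) (of_int y)" "w = Complex (of_int x') (of_int y')"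
      and "even (x + y)" "even (x' + y')"
    using assms unfolding even_gauss_def by blast
  moreover from this have "even ((x - x') + (y - y'))"
    by presburger
  ultimately show ?thesis
    by (intro even_gaussI[of _ "x - x'" "y - y'"]) simp_all
qed

lemma even_gauss_double:
  assumes "even_gauss u"
  shows "even_gauss (2 * u)"
proof -
  obtain x y where "u = Complex (of_int x) (of_int y)"
    using assms unfolding even_gauss_def by blast
  then show ?thesis
    by (intro even_gaussI[of _ "2 * x" "2 * y"]) auto
qed

lemma even_gauss_unit: "even_gauss (\<i> ^ k * Complex 1 1)"
  unfolding i_pow_mod4[of k] even_gauss_def
proof (cases k rule: mod4_cases)
  case 1
  then show "\<exists>x y. \<i> ^ (k mod 4) * Complex 1 1 = Complex (of_int x) (of_int y) \<and> even (x + y)"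
    by (intro exI[of _ 1]) (simp add: complex_eq_iff)
next
  case 2
  then show "\<exists>x y. \<i> ^ (k mod 4) * Complex 1 1 = Complex (of_int x) (of_int y) \<and> even (x + y)"
    by (intro exI[of _ "-1"] exI[of _ 1]) (simp add: complex_eq_iff)
next
  case 3
  then show "\<exists>x y. \<i> ^ (k mod 4) * Complex 1 1 = Complex (of_int x) (of_int y) \<and> even (x + y)"
    by (intro exI[of _ "-1"]) (simp add: complex_eq_iff)
next
  case 4
  then show "\<exists>x y. \<i> ^ (k mod 4) * Complex 1 1 = Complex (of_int x) (of_int y) \<and> even (x + y)"
    by (intro exI[of _ 1] exI[of _ "-1"]) (simp add: complex_eq_iff i_pow3)
qed

lemma even_gauss_subst:
  assumes "even_gauss u" "chair_at w l \<in> subst_tile (chair_at u k)"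
  shows "even_gauss w"
proof -
  have "w = 2 * u \<or> (\<exists>j. w = 2 * u - \<i> ^ j * Complex 1 1)"
    using assms(2) chair_at_eq unfolding subst_chair_at by blast
  then show ?thesis
    using even_gauss_double[OF assms(1)] even_gauss_diff[OF _ even_gauss_unit] by blast
qed

text \<open>The chair is not convex, but it is star-shaped about \<open>Complex (1/2) (1/2)\<close>,
  the middle of its corner unit square.\<close>

lemma chair_starlike:
  assumes "z \<in> chair"
  shows "(z + Complex (1/2) (1/2)) / 2 \<in> chair"
  using assms by (auto simp: mem_chair)

text \<open>If \<open>0 \<in> t\<close>, then \<open>2t\<close> contains an interior point of \<open>t\<close>, and the child of \<open>t\<close> covering that
  point overlaps \<open>t\<close>, hence equals \<open>t\<close>.\<close>

lemma even_gauss_origin: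
  assumes T: "chair_tiling T" and t: "chair_at u k \<in> T" and 0: "0 \<in> chair_at u k"
  shows "even_gauss u"
proof -
  define p where "p = u + \<i> ^ k * (- Complex (1/2) (1/2))"
  have pl: "plane_tiling T" and fp: "subst_patch T = T"
    using T by (auto simp: chair_tiling_def)
  define v where "v = u - \<i> ^ k * Complex 1 1"
  have ct: "chair_at u k = place v k chair"
    by (simp add: chair_at_def v_def)
  obtain z where z: "z \<in> chair" "0 = v + \<i> ^ k * z"
    using 0 by (auto simp: ct place_def)
  have "Complex 1 1 = Complex (1/2) (1/2) + Complex (1/2) (1/2)"
    by (simp add: complex_eq_iff)
  then have p: "p = v + \<i> ^ k * Complex (1/2) (1/2)"
    by (simp add: p_def v_def algebra_simps)
  have vz: "v = - (\<i> ^ k * z)"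
    using z(2) by (simp add: eq_neg_iff_add_eq_0)
  \<comment> \<open>\<open>p / 2\<close> is the midpoint of the origin and \<open>p\<close>, the
    image of the star centre of the chair.\<close>
  have "p / 2 = v + \<i> ^ k * ((z + Complex (1/2) (1/2)) / 2)"
    unfolding p vz by (simp add: field_simps)
  then have "p / 2 \<in> chair_at u k"
    using chair_starlike[OF z(1)] unfolding ct place_def by blast
  moreover have "chair_tile (chair_at u k)"
    using pl t by (simp add: plane_tiling_def)
  ultimately have "p \<in> \<Union>(subst_tile (chair_at u k))"
    unfolding Union_subst_tile[OF \<open>chair_tile (chair_at u k)\<close>]
    by (intro image_eqI[of _ _ "p / 2"]) simp_all
  then obtain s where s: "s \<in> subst_tile (chair_at u k)" "p \<in> s"
    by blast
  then have "s \<in> T"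
    using t fp by (auto simp: subst_patch_def)
  moreover have "p \<in> interior (chair_at u k)"
    unfolding p_def by (rule mem_interior_chair_at) auto
  ultimately have "chair_at u k = s"
    using plane_tiling_overlap_imp_eq[OF pl t] s by blast
  \<comment> \<open>A tile that is its own child has a centre fixed by one of the child maps, which
    leaves \<open>0\<close> and the \<open>\<i> ^ j * Complex 1 1\<close>.\<close>
  then have "u = 2 * u \<or> (\<exists>j. u = 2 * u - \<i> ^ j * Complex 1 1)"
    using s chair_at_eq unfolding subst_chair_at by blast
  then have "u = 0 \<or> (\<exists>j. u = \<i> ^ j * Complex 1 1)"
    by (auto simp: algebra_simps)
  moreover have "even_gauss 0"
    by (rule even_gaussI[of _ 0 0]) auto
  ultimately show ?thesis
    using even_gauss_unit by blast
qed

text \<open>The \<open>n\<close>-th ancestor contains \<open>u / 2\<^sup>n\<close>, so the ancestors stay in a bounded region and two of them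
  coincide. A recurring ancestor is closed and contains points converging to the origin.\<close>

lemma even_gauss_centre:
  assumes T: "chair_tiling T" and t: "chair_at u k \<in> T"
  shows "even_gauss u"
proof -
  have pl: "plane_tiling T" and fp: "subst_patch T = T"
    using T by (auto simp: chair_tiling_def)
  have "\<forall>t\<in>T. \<exists>s\<in>T. t \<in> subst_tile s"
    using fp unfolding subst_patch_def by blast
  then obtain par where par: "par t \<in> T" "t \<in> subst_tile (par t)" if "t \<in> T" for t
    by metis
  define anc where "anc n = (par ^^ n) (chair_at u k)" for n
  have anc_Suc: "anc (Suc n) = par (anc n)" for n
    by (simp add: anc_def)
  have ancT: "anc n \<in> T" for n
    by (induction n) (simp_all add: anc_Suc par t, simp add: anc_def t)
  have anc_sub: "anc n \<in> subst_tile (anc (Suc n))" for n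
    using par(2)[OF ancT] by (simp add: anc_Suc)
  have "\<exists>w l. anc n = chair_at w l" for n
    using plane_tiling_chair_at[OF pl ancT] by metis
  then obtain w l where wl: "anc n = chair_at (w n) (l n)" for n
    by metis
  have u_mem: "u / 2 ^ n \<in> anc n" for n
  proof (induction n)
    case 0
    show ?case
      using mem_chair_at[of u k 0] by (simp add: anc_def)
  next
    case (Suc n)
    have "u / 2 ^ n \<in> (*) 2 ` anc (Suc n)"
      using Suc anc_sub[of n] Union_subst_tile[of "anc (Suc n)"] pl ancT
      by (auto simp: plane_tiling_def)
    then show ?case
      by (auto simp: field_simps)
  qed
  have "cmod (w n) \<le> cmod u + 2" for n
  proof -
    have "\<bar>Re (u / 2 ^ n) - Re (w n)\<bar> \<le> 1" "\<bar>Im (u / 2 ^ n) - Im (w n)\<bar> \<le> 1"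
      using u_mem[of n] chair_at_subset_square unfolding wl by blast+
    then have "cmod (u / 2 ^ n - w n) \<le> 2"
      using cmod_le[of "u / 2 ^ n - w n"] by simp
    moreover have "cmod (u / 2 ^ n) \<le> cmod u"
      by (simp add: norm_divide norm_power divide_le_eq mult_le_cancel_left1)
    ultimately show ?thesis
      using norm_triangle_ineq4[of "u / 2 ^ n" "u / 2 ^ n - w n"] by simp
  qed
  then have "bounded (range w)"
    by (auto simp: bounded_iff)
  then obtain x r where r: "strict_mono r" "(w \<circ> r) \<longlonglongrightarrow> x"
    using bounded_imp_convergent_subsequence by metis
  then have "Cauchy (w \<circ> r)"
    using LIMSEQ_imp_Cauchy by blast
  then obtain N where N: "dist ((w \<circ> r) i) ((w \<circ> r) j) < 1" if "i \<ge> N" "j \<ge> N" for i j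
    unfolding Cauchy_def using zero_less_one by metis
  \<comment> \<open>Two terms of a convergent subsequence of centres are less than 1 apart. Their
    tiles then coincide, which makes \<open>p\<close> a period of the ancestor sequence from index
    \<open>n\<close> on.\<close>
  define n p where "n = r N" and "p = r (Suc N) - r N"
  have "p > 0" and rN: "r (Suc N) = n + p"
    using r(1) by (auto simp: n_def p_def strict_mono_def less_imp_le)
  have "cmod (w n - w (n + p)) < 1"
    using N[of N "Suc N"] rN by (simp add: n_def dist_norm)
  then have "anc n = anc (n + p)"
    using ancT[of n] ancT[of "n + p"] abs_Re_le_cmod[of "w n - w (n + p)"]
      abs_Im_le_cmod[of "w n - w (n + p)"] unfolding wl
    by (intro plane_tiling_near_imp_eq[OF pl]) auto
  then have step: "anc (n + m) = anc (n + p + m)" for m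
    by (induction m) (simp_all add: anc_Suc)
  have per: "anc (n + p * m) = anc n" for m
  proof (induction m)
    case (Suc m)
    then show ?case using step[of "p * m"] by (simp add: algebra_simps)
  qed simp
  have "(\<lambda>m. u * (1 / 2) ^ m) \<longlonglongrightarrow> u * 0"
    by (intro tendsto_intros LIMSEQ_power_zero) (simp add: norm_divide)
  then have "(\<lambda>m. u / 2 ^ m) \<longlonglongrightarrow> 0"
    by (simp add: power_one_over)
  moreover have "strict_mono (\<lambda>m. n + p * m)"
    using \<open>p > 0\<close> by (auto simp: strict_mono_def)
  ultimately have lim: "(\<lambda>m. u / 2 ^ (n + p * m)) \<longlonglongrightarrow> 0"
    using LIMSEQ_subseq_LIMSEQ[of "\<lambda>m. u / 2 ^ m"] by (simp add: o_def)
  have mem: "u / 2 ^ (n + p * m) \<in> anc n" for m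
    using u_mem[of "n + p * m"] per by simp
  have "closed (anc n)"
    by (simp add: wl closed_chair_at)
  from closed_sequentially[OF this mem lim] have "0 \<in> anc n" .
  then have "even_gauss (w n)"
    using even_gauss_origin[OF T] ancT[of n] unfolding wl by blast
  \<comment> \<open>Membership in the lattice passes from parent to child, down from the recurring
    ancestor to the tile itself.\<close>
  then have "even_gauss (w 0)"
  proof (induction n)
    case (Suc n)
    then show ?case
      using even_gauss_subst anc_sub[of n] unfolding wl by blast
  qed
  moreover have "chair_at (w 0) (l 0) = chair_at u k"
    using wl[of 0] by (simp add: anc_def)
  ultimately show ?thesis
    using chair_at_eq by metis
qed

section \<open>A proper colouring by centres\<close>

lemma unit_cases:
  obtains "\<i> ^ k * Complex 1 1 = Complex 1 1" | "\<i> ^ k * Complex 1 1 = Complex (-1) 1"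
    | "\<i> ^ k * Complex 1 1 = Complex (-1) (-1)" | "\<i> ^ k * Complex 1 1 = Complex 1 (-1)"
  using i_pow_mod4[of k]
  by (cases k rule: mod4_cases) (auto simp: complex_eq_iff i_pow3)

text \<open>The floors read off the integer coordinates of a centre. Both have the same parity, so
  that of the real part separates central tiles from the others. A step of 2 in one coordinate
  changes the sum modulo 4, which gives the checkerboard on odd centres.\<close>

definition centre_colour :: "complex \<Rightarrow> colour" where
  "centre_colour u =
     (if even \<lfloor>Re u\<rfloor> then Green else if 4 dvd \<lfloor>Re u\<rfloor> + \<lfloor>Im u\<rfloor> then Blue else Red)"

definition chair_colour :: "complex set \<Rightarrow> colour" where
  "chair_colour t = centre_colour (THE u. \<exists>k. t = chair_at u k)"

lemma chair_colour_chair_at [simp]: "chair_colour (chair_at u k) = centre_colour u"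
proof -
  have "(THE w. \<exists>l. chair_at u k = chair_at w l) = u"
    using chair_at_eq by (intro the_equality) blast+
  then show ?thesis
    by (simp add: chair_colour_def)
qed

text \<open>Only the central child has even coordinates. Its centre doubles that of its parent,
  whose coordinate sum is already even.\<close>

lemma green_centre:
  assumes T: "chair_tiling T" and t: "chair_at (Complex (of_int x) (of_int y)) k \<in> T" and "even x"
  shows "4 dvd x + y"
proof -
  have pl: "plane_tiling T" and fp: "subst_patch T = T"
    using T by (auto simp: chair_tiling_def)
  obtain s where s: "s \<in> T" "chair_at (Complex (of_int x) (of_int y)) k \<in> subst_tile s"
    using t fp unfolding subst_patch_def by blast
  obtain w l where w: "s = chair_at w l"
    using plane_tiling_chair_at[OF pl s(1)] by blast
  then have "even_gauss w"
    using even_gauss_centre[OF T] s by blast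
  then obtain x' y' where xy: "w = Complex (of_int x') (of_int y')" "even (x' + y')"
    by (auto simp: even_gauss_def)
  have "Complex (of_int x) (of_int y) = 2 * w \<or>
      (\<exists>j. Complex (of_int x) (of_int y) = 2 * w - \<i> ^ j * Complex 1 1)"
    using s(2) chair_at_eq unfolding w subst_chair_at by blast
  then show ?thesis
  proof
    assume "Complex (of_int x) (of_int y) = 2 * w"
    then have "real_of_int x = of_int (2 * x')" "real_of_int y = of_int (2 * y')"
      by (simp_all add: xy complex_eq_iff)
    then have "x = 2 * x'" "y = 2 * y'"
      by (simp_all only: of_int_eq_iff)
    then show ?thesis
      using xy(2) by presburger
  next
    assume "\<exists>j. Complex (of_int x) (of_int y) = 2 * w - \<i> ^ j * Complex 1 1"
    then obtain j where j: "Complex (of_int x) (of_int y) = 2 * w - \<i> ^ j * Complex 1 1"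
      by blast
    have "real_of_int x = of_int (2 * x' - 1) \<or> real_of_int x = of_int (2 * x' + 1)"
      by (cases j rule: unit_cases) (use j in \<open>simp_all add: xy complex_eq_iff\<close>)
    then have "x = 2 * x' - 1 \<or> x = 2 * x' + 1"
      by (simp only: of_int_eq_iff)
    then show ?thesis
      using \<open>even x\<close> by presburger
  qed
qed

text \<open>Equal colours make both coordinate differences of the centres even, with sum divisible
  by 4. Adjacency bounds them by 2 and excludes that both reach 2, so they vanish.\<close>

lemma face_colouring_chair_colour:
  assumes T: "chair_tiling T"
  shows "face_colouring T chair_colour"
  unfolding face_colouring_def
proof (intro ballI impI notI)
  fix s t
  assume st: "s \<in> T" "t \<in> T" and ne: "s \<noteq> t \<and> share_segment s t"
    and col: "chair_colour s = chair_colour t"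
  have pl: "plane_tiling T"
    using T by (auto simp: chair_tiling_def)
  obtain u k w l where uw: "s = chair_at u k" "t = chair_at w l"
    using plane_tiling_chair_at[OF pl] st by metis
  have "even_gauss u" "even_gauss w"
    using even_gauss_centre[OF T] st unfolding uw by blast+
  then obtain x y x' y' where u: "u = Complex (of_int x) (of_int y)" "even (x + y)"
      and w: "w = Complex (of_int x') (of_int y')" "even (x' + y')"
    unfolding even_gauss_def by blast
  have "\<bar>Re u - Re w\<bar> \<le> 2" "\<bar>Im u - Im w\<bar> \<le> 2" "\<bar>Re u - Re w\<bar> < 2 \<or> \<bar>Im u - Im w\<bar> < 2"
    using share_segment_centres ne unfolding uw by blast+
  then have "\<bar>real_of_int (x - x')\<bar> \<le> 2" "\<bar>real_of_int (y - y')\<bar> \<le> 2"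
      "\<bar>real_of_int (x - x')\<bar> < 2 \<or> \<bar>real_of_int (y - y')\<bar> < 2"
    by (simp_all add: u w)
  then have bd: "\<bar>x - x'\<bar> \<le> 2" "\<bar>y - y'\<bar> \<le> 2" "\<bar>x - x'\<bar> < 2 \<or> \<bar>y - y'\<bar> < 2"
    by linarith+
  have "even x \<Longrightarrow> 4 dvd x + y" "even x' \<Longrightarrow> 4 dvd x' + y'"
    using green_centre[OF T] st unfolding uw u w by blast+
  moreover have "even x = even x'" "odd x \<Longrightarrow> (4 dvd x + y) = (4 dvd x' + y')"
    using col by (auto simp: uw u w centre_colour_def split: if_splits)
  ultimately have "x = x' \<and> y = y'"
    using bd u(2) w(2) by presburger
  then have "s = t"
    using plane_tiling_near_imp_eq[OF pl, of u k w l] st by (simp add: uw u w)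
  then show False
    using ne by simp
qed

section \<open>Layout of the first level supertiles\<close>

text \<open>Counterclockwise quarter turns from the bottom left quadrant; this is also the
  orientation of the child lying in that quadrant.\<close>

fun quadrant_turn :: "quadrant \<Rightarrow> nat" where
  "quadrant_turn BottomLeft = 0"
| "quadrant_turn BottomRight = 1"
| "quadrant_turn TopRight = 2"
| "quadrant_turn TopLeft = 3"

definition quadrant_tile :: "complex \<Rightarrow> quadrant \<Rightarrow> complex set" where
  "quadrant_tile u e =
     chair_at (2 * u - \<i> ^ quadrant_turn e * Complex 1 1) (quadrant_turn e)"

lemma UNIV_quadrant: "UNIV = {BottomLeft, BottomRight, TopLeft, TopRight}"
  using quadrant.exhaust by blast

lemma Compl_quadrant:
  "- {BottomLeft} = {BottomRight, TopLeft, TopRight}"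
  "- {BottomRight} = {BottomLeft, TopLeft, TopRight}"
  "- {TopLeft} = {BottomLeft, BottomRight, TopRight}"
  "- {TopRight} = {BottomLeft, BottomRight, TopLeft}"
  unfolding Compl_eq_Diff_UNIV UNIV_quadrant by auto

text \<open>The removed quadrant lies opposite the outer corner of the expanded tile, hence turn
  \<open>k + 2\<close>; the corner children take the other three turns modulo 4.\<close>

lemma subst_quadrant_tiles:
  assumes "k < 4" "quadrant_turn d = (k + 2) mod 4"
  shows "subst_tile (chair_at u k) = insert (chair_at (2 * u) k) (quadrant_tile u ` (- {d}))"
proof -
  have *: "chair_at (2 * u - \<i> ^ j * Complex 1 1) j =
      chair_at (2 * u - \<i> ^ (j mod 4) * Complex 1 1) (j mod 4)" for j
    using i_pow_mod4[of j] chair_at_mod4[of _ j] by simp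
  have "(\<lambda>j. chair_at (2 * u - \<i> ^ j * Complex 1 1) j) ` {k, k + 1, k + 3} =
      (\<lambda>j. chair_at (2 * u - \<i> ^ j * Complex 1 1) j) ` ((\<lambda>j. j mod 4) ` {k, k + 1, k + 3})"
    unfolding image_image using * by (intro image_cong) auto
  also have "(\<lambda>j. j mod 4) ` {k, k + 1, k + 3} = quadrant_turn ` (- {d})"
  proof -
    consider "k = 0" | "k = 1" | "k = 2" | "k = 3" using \<open>k < 4\<close> by linarith
    then show ?thesis
      using assms(2) by cases (cases d; auto simp: Compl_quadrant)+
  qed
  finally show ?thesis
    by (simp add: subst_chair_at image_image quadrant_tile_def)
qed

text \<open>The union is the doubled tile. The set differences are compared before closure, since
  injective linear images commute with closure.\<close>

lemma Union_subst_chair_at: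
  assumes "k < 4" "quadrant_turn d = (k + 2) mod 4"
  shows "\<Union>(subst_tile (chair_at u k)) =
    closure (square4 (2 * u - Complex 2 2) - quadrant_square (2 * u - Complex 2 2) d)"
proof -
  define v where "v = u - \<i> ^ k * Complex 1 1"
  define L where "L = cbox 0 (Complex 2 2) - cbox (Complex 1 1) (Complex 2 2)"
  have "square4 (2 * u - Complex 2 2) - quadrant_square (2 * u - Complex 2 2) d =
      (*) 2 ` place v k L"
  proof (rule set_eqI)
    fix z
    have "z \<in> (*) 2 ` place v k L \<longleftrightarrow> z / 2 \<in> place v k L"
      by (auto simp: image_iff intro!: bexI[of _ "z / 2"])
    also have "\<dots> \<longleftrightarrow> (z / 2 - u) / \<i> ^ k + Complex 1 1 \<in> L"
    proof -
      have "(z / 2 - v) / \<i> ^ k = (z / 2 - u) / \<i> ^ k + Complex 1 1"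
        by (simp add: v_def field_simps)
      then show ?thesis by (simp add: mem_place)
    qed
    also have "\<dots> \<longleftrightarrow>
        z \<in> square4 (2 * u - Complex 2 2) - quadrant_square (2 * u - Complex 2 2) d"
    proof -
      consider "k = 0" | "k = 1" | "k = 2" | "k = 3" using \<open>k < 4\<close> by linarith
      then show ?thesis
        using assms(2)
        by cases (cases d; auto simp: L_def square4_def quadrant_square_def in_cbox_complex_iff i_pow3)+
    qed
    finally show "z \<in> square4 (2 * u - Complex 2 2) - quadrant_square (2 * u - Complex 2 2) d \<longleftrightarrow>
        z \<in> (*) 2 ` place v k L" ..
  qed
  also have "closure ((*) 2 ` place v k L) = (*) 2 ` closure (place v k L)"
    by (rule closure_injective_linear_image[symmetric]) (auto intro: linear_times simp: inj_on_def)
  also have "closure (place v k L) = chair_at u k"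
    by (simp add: closure_place L_def chair_def[symmetric] chair_at_def v_def)
  finally show ?thesis
    using Union_subst_tile[of "chair_at u k"] by (auto simp: chair_tile_def chair_at_def)
qed

lemma centre_tile_crosses_quadrants:
  assumes "k < 4"
  shows "\<not> chair_at (2 * u) k \<subseteq> quadrant_square (2 * u - Complex 2 2) e"
proof
  assume sub: "chair_at (2 * u) k \<subseteq> quadrant_square (2 * u - Complex 2 2) e"
  consider "k = 0" | "k = 1" | "k = 2" | "k = 3" using \<open>k < 4\<close> by linarith
  \<comment> \<open>These two points lie in the central tile for every orientation, on opposite
    sides of its centre, and no quadrant contains both.\<close>
  then have "2 * u + 1 \<in> chair_at (2 * u) k \<and> 2 * u - 1 \<in> chair_at (2 * u) k"
    by cases (simp_all add: chair_at_eq_Collect chair_at_eq_Collect(2)[simplified])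
  then have "2 * u + 1 \<in> quadrant_square (2 * u - Complex 2 2) e"
    "2 * u - 1 \<in> quadrant_square (2 * u - Complex 2 2) e"
    using sub by blast+
  then show False
    by (cases e) (simp_all add: quadrant_square_def in_cbox_complex_iff)
qed

lemma quadrant_tile_subset: "quadrant_tile u e \<subseteq> quadrant_square (2 * u - Complex 2 2) e"
proof
  fix z
  assume "z \<in> quadrant_tile u e"
  note sq = chair_at_subset_square[OF this[unfolded quadrant_tile_def]]
  then show "z \<in> quadrant_square (2 * u - Complex 2 2) e"
    by (cases e) (simp_all add: quadrant_square_def in_cbox_complex_iff abs_le_iff i_pow3)
qed

text \<open>The centre is \<open>(2 * x + a, 2 * y + b)\<close> with \<open>a\<close> and
  \<open>b\<close> equal to 1 or -1. As \<open>x + y\<close> is even, \<open>2 * x + 2 * y\<close>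
  vanishes modulo 4, so the colour depends only on the quadrant.\<close>

lemma centre_colour_quadrant_tile:
  assumes "even_gauss u"
  shows "centre_colour (2 * u - \<i> ^ quadrant_turn e * Complex 1 1) = quadrant_colour e"
proof -
  obtain x y where u: "u = Complex (of_int x) (of_int y)" "even (x + y)"
    using assms by (auto simp: even_gauss_def)
  define c where "c = 2 * u - \<i> ^ quadrant_turn e * Complex 1 1"
  have "\<exists>a b. Re c = of_int (2 * x + a) \<and> Im c = of_int (2 * y + b) \<and> odd a \<and>
      quadrant_colour e = (if 4 dvd a + b then Blue else Red)"
  proof (cases e)
    case BottomLeft
    then show ?thesis by (intro exI[of _ "- 1"]) (simp add: c_def u)
  next
    case BottomRight
    then show ?thesis by (intro exI[of _ 1] exI[of _ "- 1"]) (simp add: c_def u)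
  next
    case TopLeft
    then show ?thesis by (intro exI[of _ "- 1"] exI[of _ 1]) (simp add: c_def u i_pow3)
  next
    case TopRight
    then show ?thesis by (intro exI[of _ 1]) (simp add: c_def u)
  qed
  then obtain a b where ab: "Re c = of_int (2 * x + a)" "Im c = of_int (2 * y + b)" "odd a"
      "quadrant_colour e = (if 4 dvd a + b then Blue else Red)"
    by blast
  have "\<lfloor>Re c\<rfloor> = 2 * x + a" "\<lfloor>Im c\<rfloor> = 2 * y + b"
    unfolding ab by (rule floor_of_int)+
  moreover have "4 dvd (2 * x + a) + (2 * y + b) \<longleftrightarrow> 4 dvd a + b"
    using u(2) by presburger
  ultimately show ?thesis
    using ab(3,4) unfolding c_def[symmetric] centre_colour_def by simp
qed

lemma coloured_by_orientation_subst:
  assumes "even_gauss u" "k < 4"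
  shows "coloured_by_orientation (subst_tile (chair_at u k)) chair_colour"
proof -
  have "(k + 2) mod 4 \<in> {0, 1, 2, 3}"
    by auto
  then obtain d where d: "quadrant_turn d = (k + 2) mod 4"
    using quadrant_turn.simps by (metis insertE emptyE)
  have "supertile_layout (subst_tile (chair_at u k)) (2 * u - Complex 2 2) d
      (chair_at (2 * u) k) (quadrant_tile u)"
    unfolding supertile_layout_def
    by (intro conjI allI impI Union_subst_chair_at[OF assms(2) d] subst_quadrant_tiles[OF assms(2) d]
        centre_tile_crosses_quadrants[OF assms(2)] quadrant_tile_subset)
  moreover have "chair_colour (chair_at (2 * u) k) = Green"
  proof -
    obtain x y where u: "u = Complex (of_int x) (of_int y)"
      using assms by (auto simp: even_gauss_def)
    have "Re (2 * u) = of_int (2 * x)"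
      by (simp add: u)
    then have "\<lfloor>Re (2 * u)\<rfloor> = 2 * x"
      by (simp only: floor_of_int)
    then show ?thesis
      by (simp add: centre_colour_def)
  qed
  moreover have "chair_colour (quadrant_tile u e) = quadrant_colour e" for e
    by (simp add: quadrant_tile_def centre_colour_quadrant_tile[OF assms(1)])
  ultimately show ?thesis
    unfolding coloured_by_orientation_def by blast
qed

section \<open>Three mutually adjacent tiles\<close>

lemma closed_segment_affine_subset:
  assumes "\<And>s. 0 \<le> s \<Longrightarrow> s \<le> 1 \<Longrightarrow> c + \<i> ^ k * (complex_of_real (1 - s) * a + complex_of_real s * b) \<in> S"
  shows "closed_segment (c + \<i> ^ k * a) (c + \<i> ^ k * b) \<subseteq> S"
proof
  fix z
  assume "z \<in> closed_segment (c + \<i> ^ k * a) (c + \<i> ^ k * b)"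
  then obtain s where s: "0 \<le> s" "s \<le> 1" "z = (1 - s) *\<^sub>R (c + \<i> ^ k * a) + s *\<^sub>R (c + \<i> ^ k * b)"
    by (auto simp: in_segment)
  then have "z = c + \<i> ^ k * (complex_of_real (1 - s) * a + complex_of_real s * b)"
    by (simp add: scaleR_conv_of_real algebra_simps)
  then show "z \<in> S"
    using assms s by simp
qed

text \<open>The central tile of any supertile and its corner children of orientations
  \<open>k\<close> and \<open>k + 1\<close> touch pairwise.\<close>

lemma chair_tiling_triangle:
  assumes T: "chair_tiling T"
  obtains r s t where "r \<in> T" "s \<in> T" "t \<in> T" "r \<noteq> s" "r \<noteq> t" "s \<noteq> t"
    "share_segment r s" "share_segment r t" "share_segment s t"
proof -
  have pl: "plane_tiling T" and fp: "subst_patch T = T"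
    using T by (auto simp: chair_tiling_def)
  then have "T \<noteq> {}"
    by (auto simp: plane_tiling_def)
  then obtain p where "p \<in> T"
    by blast
  then obtain u k where p: "p = chair_at u k"
    using plane_tiling_chair_at[OF pl] by metis
  define r where "r = chair_at (2 * u) k"
  define s where "s = chair_at (2 * u - \<i> ^ k * Complex 1 1) k"
  define t where "t = chair_at (2 * u - \<i> ^ (k + 1) * Complex 1 1) (k + 1)"
  have "{r, s, t} \<subseteq> subst_tile p"
    by (simp add: p subst_chair_at r_def s_def t_def)
  then have in_T: "r \<in> T" "s \<in> T" "t \<in> T"
    using \<open>p \<in> T\<close> fp by (auto simp: subst_patch_def)
  have ne: "r \<noteq> s" "r \<noteq> t" "s \<noteq> t"
    unfolding r_def s_def t_def by (auto dest!: chair_at_eq simp: complex_eq_iff[of "Complex 1 1"])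
  have mem_r: "2 * u + \<i> ^ k * z \<in> r \<longleftrightarrow>
      \<bar>Re z\<bar> \<le> 1 \<and> \<bar>Im z\<bar> \<le> 1 \<and> (Re z \<le> 0 \<or> Im z \<le> 0)" for z
    unfolding r_def by (rule mem_chair_at)
  have mem_s: "2 * u + \<i> ^ k * z \<in> s \<longleftrightarrow>
      \<bar>Re z + 1\<bar> \<le> 1 \<and> \<bar>Im z + 1\<bar> \<le> 1 \<and> (Re z + 1 \<le> 0 \<or> Im z + 1 \<le> 0)" for z
  proof -
    have "2 * u + \<i> ^ k * z = (2 * u - \<i> ^ k * Complex 1 1) + \<i> ^ k * (z + Complex 1 1)"
      by (simp add: algebra_simps)
    then show ?thesis
      unfolding s_def by (simp only: mem_chair_at) simp
  qed
  have mem_t: "2 * u + \<i> ^ k * z \<in> t \<longleftrightarrow>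
      \<bar>Im z + 1\<bar> \<le> 1 \<and> \<bar>1 - Re z\<bar> \<le> 1 \<and> (Im z + 1 \<le> 0 \<or> 1 - Re z \<le> 0)" for z
  proof -
    \<comment> \<open>The tile \<open>t\<close> is turned once more, so its local coordinate is that
      of the other two divided by \<open>\<i>\<close>, up to a shift.\<close>
    have "2 * u + \<i> ^ k * z = (2 * u - \<i> ^ (k + 1) * Complex 1 1) + \<i> ^ (k + 1) * (Complex 1 1 - \<i> * z)"
      by (simp add: algebra_simps)
    then show ?thesis
      unfolding t_def by (simp only: mem_chair_at) (simp add: add.commute)
  qed
  \<comment> \<open>In the turned coordinates, the first two segments are halves of the left and
    lower sides of the bounding square of \<open>r\<close>. The third lies on the common side of the
    bounding squares of \<open>s\<close> and \<open>t\<close>.\<close>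
  have seg: "closed_segment (2 * u + \<i> ^ k * Complex (-1) (-1)) (2 * u + \<i> ^ k * Complex (-1) 0) \<subseteq> r \<inter> s"
    "closed_segment (2 * u + \<i> ^ k * Complex 0 (-1)) (2 * u + \<i> ^ k * Complex 1 (-1)) \<subseteq> r \<inter> t"
    "closed_segment (2 * u + \<i> ^ k * Complex 0 (-2)) (2 * u + \<i> ^ k * Complex 0 (-1)) \<subseteq> s \<inter> t"
    by (rule closed_segment_affine_subset; unfold Int_iff mem_r mem_s mem_t; simp)+
  have "share_segment r s" "share_segment r t" "share_segment s t"
    by (rule share_segmentI[OF pl _ _ _ _ seg(1)], simp_all add: in_T ne)
      (rule share_segmentI[OF pl _ _ _ _ seg(2)], simp_all add: in_T ne,
       rule share_segmentI[OF pl _ _ _ _ seg(3)], simp_all add: in_T ne)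
  then show ?thesis
    using that in_T ne by blast
qed

theorem theorem3p3:
  fixes T :: "complex set set"
  assumes "chair_tiling T"
  shows "(face_colourable T 3 \<and> (\<forall>n. face_colourable T n \<longrightarrow> 3 \<le> n)) \<and>
    (\<exists>c :: complex set \<Rightarrow> colour.
       (\<forall>t\<in>T. coloured_by_orientation (subst_tile t) c) \<and> face_colouring T c)"
proof (intro conjI allI impI exI[of _ chair_colour] ballI)
  have pl: "plane_tiling T"
    using assms by (simp add: chair_tiling_def)
  show fc: "face_colouring T chair_colour"
    using assms by (rule face_colouring_chair_colour)
  show "coloured_by_orientation (subst_tile t) chair_colour" if t: "t \<in> T" for t
  proof -
    obtain u k where uk: "t = chair_at u k" "k < 4"
      using plane_tiling_chair_at[OF pl t] .
    then show ?thesis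
      using coloured_by_orientation_subst even_gauss_centre[OF assms] t by simp
  qed
  show "face_colourable T 3"
    unfolding face_colourable_def
  proof (intro exI conjI)
    define h :: "colour \<Rightarrow> nat" where "h = case_colour 0 1 2"
    have "h x < 3" "h x = h y \<Longrightarrow> x = y" for x y
      by (cases x; cases y; simp add: h_def)+
    then show "(h \<circ> chair_colour) ` T \<subseteq> {..<3}" "face_colouring T (h \<circ> chair_colour)"
      using fc unfolding face_colouring_def o_def by blast+
  qed
  show "3 \<le> n" if n: "face_colourable T n" for n
  proof -
    obtain c :: "complex set \<Rightarrow> nat" where c: "c ` T \<subseteq> {..<n}" "face_colouring T c"
      using n by (auto simp: face_colourable_def)
    obtain r s t where "r \<in> T" "s \<in> T" "t \<in> T" "r \<noteq> s" "r \<noteq> t" "s \<noteq> t"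
        "share_segment r s" "share_segment r t" "share_segment s t"
      using chair_tiling_triangle[OF assms] .
    then have "c r \<noteq> c s" "c r \<noteq> c t" "c s \<noteq> c t" "c r < n" "c s < n" "c t < n"
      using c by (auto simp: face_colouring_def)
    then show "3 \<le> n"
      by linarith
  qed
qed

end
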